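(* Let $\{(Q_\lambda,\ast_\lambda)\}_{\lambda\in\Lambda}$ be a family of nontrivial connected quandles and let $\bigsqcup^{\mathrm{free}}_{\lambda\in\Lambda}Q_\lambda$ denote their interaction-free union. Then there is a canonical bijection $$\operatorname{Good}\Bigl(\bigsqcup\nolimits^{\mathrm{free}}_{\lambda\in\Lambda}Q_\lambda\Bigr)\;\cong\;\prod_{\lambda\in\Lambda}\operatorname{Good}(Q_\lambda,\ast_\lambda).$$
   Context: A quandle is a set $Q$ with a binary operation $\ast$ such that: (1) $x\ast x=x$ for all $x$; (2) for every $y\in Q$ the map $s_y\colon Q\to Q$, $s_y(x)=x\ast y$, is invertible; (3) $(x\ast y)\ast z=(x\ast z)\ast(y\ast z)$ for all $x,y,z$. Write $x\ast^{-1}y:=s_y^{-1}(x)$. A quandle is trivial if $x\ast y=x$ for all $x,y$, and nontrivial otherwise. A quandle is connected if its inner automorphism group, the group of bijections of $Q$ generated by $\{s_y\mid y\in Q\}$, acts transitively on $Q$. A good involution on $(Q,\ast)$ is a map $\rho\colon Q\to Q$ with $\rho\circ\rho=\mathrm{id}_Q$, $\rho(x\ast y)=\rho(x)\ast y$ and $x\ast\rho(y)=x\ast^{-1}y$ for all $x,y\in Q$; $\operatorname{Good}(Q,\ast)$ is the set of good involutions. The interaction-free union $\bigsqcup^{\mathrm{free}}_{\lambda}Q_\lambda$ is the disjoint union $\bigsqcup_\lambda Q_\lambda$ with the operation $x\ast_{\mathrm{free}}y=x\ast_\lambda y$ if $x,y\in Q_\lambda$ for some $\lambda$, and $x\ast_{\mathrm{free}}y=x$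 otherwise; it is a quandle. *)

theory Defs
  imports "HOL-Algebra.Generated_Groups" "HOL-Algebra.Group_Action"
begin

(* Quandles live on a carrier set Q; the operation is unconstrained outside Q.
   Closure of Q under the operation is part of right_bij. *)

locale quandle =
  fixes Q :: "'a set" and qop :: "'a \<Rightarrow> 'a \<Rightarrow> 'a" (infixl "\<star>" 70)
  assumes idem: "x \<in> Q \<Longrightarrow> x \<star> x = x"
    and right_bij: "y \<in> Q \<Longrightarrow> bij_betw (\<lambda>x. x \<star> y) Q Q"
    and right_distrib:
      "\<lbrakk>x \<in> Q; y \<in> Q; z \<in> Q\<rbrakk> \<Longrightarrow> (x \<star> y) \<star> z = (x \<star> z) \<star> (y \<star> z)"

definition right_translation :: "'a set \<Rightarrow> ('a \<Rightarrow> 'a \<Rightarrow> 'a) \<Rightarrow> 'a \<Rightarrow> 'a \<Rightarrow> 'a" where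
  "right_translation Q qop y = (\<lambda>x\<in>Q. qop x y)"

definition quandle_inv :: "'a set \<Rightarrow> ('a \<Rightarrow> 'a \<Rightarrow> 'a) \<Rightarrow> 'a \<Rightarrow> 'a \<Rightarrow> 'a" where
  "quandle_inv Q qop x y = inv_into Q (right_translation Q qop y) x"

definition trivial_quandle :: "'a set \<Rightarrow> ('a \<Rightarrow> 'a \<Rightarrow> 'a) \<Rightarrow> bool" where
  "trivial_quandle Q qop \<longleftrightarrow> quandle Q qop \<and> (\<forall>x\<in>Q. \<forall>y\<in>Q. qop x y = x)"

definition nontrivial_quandle :: "'a set \<Rightarrow> ('a \<Rightarrow> 'a \<Rightarrow> 'a) \<Rightarrow> bool" where
  "nontrivial_quandle Q qop \<longleftrightarrow> quandle Q qop \<and> \<not> trivial_quandle Q qop"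

definition inner_group :: "'a set \<Rightarrow> ('a \<Rightarrow> 'a \<Rightarrow> 'a) \<Rightarrow> ('a \<Rightarrow> 'a) monoid" where
  "inner_group Q qop =
     (BijGroup Q)\<lparr>carrier := generate (BijGroup Q) (right_translation Q qop ` Q)\<rparr>"

definition connected_quandle :: "'a set \<Rightarrow> ('a \<Rightarrow> 'a \<Rightarrow> 'a) \<Rightarrow> bool" where
  "connected_quandle Q qop \<longleftrightarrow>
     quandle Q qop \<and> transitive_action (inner_group Q qop) Q (\<lambda>g. g)"

(* Self-maps of Q are represented extensionally, so that distinct elements of
   good_involutions Q qop are distinct as maps on Q. *)
definition good_involutions :: "'a set \<Rightarrow> ('a \<Rightarrow> 'a \<Rightarrow> 'a) \<Rightarrow> ('a \<Rightarrow> 'a) set" where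
  "good_involutions Q qop =
     {\<rho> \<in> Q \<rightarrow>\<^sub>E Q.
        (\<forall>x\<in>Q. \<rho> (\<rho> x) = x) \<and>
        (\<forall>x\<in>Q. \<forall>y\<in>Q. \<rho> (qop x y) = qop (\<rho> x) y) \<and>
        (\<forall>x\<in>Q. \<forall>y\<in>Q. qop x (\<rho> y) = quandle_inv Q qop x y)}"

(* The interaction-free union has carrier Sigma L Q, with the index as a tag. *)
definition free_union_op ::
    "('i \<Rightarrow> 'a \<Rightarrow> 'a \<Rightarrow> 'a) \<Rightarrow> 'i \<times> 'a \<Rightarrow> 'i \<times> 'a \<Rightarrow> 'i \<times> 'a" where
  "free_union_op qop p q =
     (if fst p = fst q then (fst p, qop (fst p) (snd p) (snd q)) else p)"

(* The family of restrictions of a self-map of Sigma L Q to the components; the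
   tag of the value is dropped, which loses nothing if each component is preserved. *)
definition component_maps ::
    "'i set \<Rightarrow> ('i \<Rightarrow> 'a set) \<Rightarrow> ('i \<times> 'a \<Rightarrow> 'i \<times> 'a) \<Rightarrow> 'i \<Rightarrow> 'a \<Rightarrow> 'a" where
  "component_maps L Q \<rho> = (\<lambda>i\<in>L. \<lambda>x\<in>Q i. snd (\<rho> (i, x)))"

lemma right_translation_Bij:
  assumes "quandle Q qop" "y \<in> Q"
  shows "right_translation Q qop y \<in> Bij Q"
proof -
  have "bij_betw (right_translation Q qop y) Q Q"
    using quandle.right_bij[OF assms] by (simp add: right_translation_def cong: bij_betw_cong)
  then show ?thesis
    by (simp add: Bij_def right_translation_def)
qed

lemma transitive_inner_group_iff:
  assumes "quandle Q qop"
  shows "transitive_action (inner_group Q qop) Q (\<lambda>g. g) \<longleftrightarrow>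
    (\<forall>x\<in>Q. \<forall>y\<in>Q. \<exists>g \<in> generate (BijGroup Q) (right_translation Q qop ` Q). g x = y)"
proof -
  have "right_translation Q qop ` Q \<subseteq> carrier (BijGroup Q)"
    using right_translation_Bij[OF assms] by (auto simp: BijGroup_def)
  then have "subgroup (generate (BijGroup Q) (right_translation Q qop ` Q)) (BijGroup Q)"
    using group.generate_is_subgroup[OF group_BijGroup] by blast
  then have "group_hom (inner_group Q qop) (BijGroup Q) id"
    unfolding inner_group_def by (rule group.canonical_inj_is_hom[OF group_BijGroup])
  then have "group_action (inner_group Q qop) Q (\<lambda>g. g)"
    by (simp add: group_action_def id_def)
  then show ?thesis
    by (auto simp: transitive_action_def transitive_action_axioms_def inner_group_def)
qed

lemma quandle_free_union:
  assumes "\<And>i. i \<in> L \<Longrightarrow> quandle (Q i) (qop i)"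
  shows "quandle (Sigma L Q) (free_union_op qop)"
proof
  fix p assume "p \<in> Sigma L Q"
  then show "free_union_op qop p p = p"
    using quandle.idem[OF assms] by (auto simp: free_union_op_def)
next
  fix q assume q: "q \<in> Sigma L Q"
  then obtain j b where jb: "q = (j, b)" "j \<in> L" "b \<in> Q j" by auto
  have bij: "bij_betw (\<lambda>x. qop j x b) (Q j) (Q j)"
    using quandle.right_bij[OF assms] jb by blast
  show "bij_betw (\<lambda>p. free_union_op qop p q) (Sigma L Q) (Sigma L Q)"
  proof (rule bij_betwI')
    fix p p' assume "p \<in> Sigma L Q" "p' \<in> Sigma L Q"
    then show "(free_union_op qop p q = free_union_op qop p' q) = (p = p')"
      using bij by (auto simp: free_union_op_def jb bij_betw_def inj_on_def)
  next
    fix p assume "p \<in> Sigma L Q"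
    then show "free_union_op qop p q \<in> Sigma L Q"
      using bij by (auto simp: free_union_op_def jb bij_betw_def)
  next
    fix p assume p: "p \<in> Sigma L Q"
    show "\<exists>x\<in>Sigma L Q. p = free_union_op qop x q"
    proof (cases "fst p = j")
      case False
      then show ?thesis using p by (intro bexI[of _ p]) (auto simp: free_union_op_def jb)
    next
      case True
      then have "snd p \<in> (\<lambda>x. qop j x b) ` Q j"
        using p bij by (auto simp: bij_betw_def)
      then obtain x where "x \<in> Q j" "snd p = qop j x b" by auto
      then show ?thesis
        using True jb by (intro bexI[of _ "(j, x)"]) (auto simp: free_union_op_def prod_eq_iff)
    qed
  qed
next
  fix p q r assume "p \<in> Sigma L Q" "q \<in> Sigma L Q" "r \<in> Sigma L Q"
  then show "free_union_op qop (free_union_op qop p q) r =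
      free_union_op qop (free_union_op qop p r) (free_union_op qop q r)"
    using quandle.right_distrib[OF assms] by (auto simp: free_union_op_def)
qed

end

theory Submission
  imports Defs
begin

text \<open>
  Gluing a family of good involutions of the components always gives a good involution of the
  interaction-free union, since elements of distinct components act trivially on each other.
  The substance is the converse: a good involution \<open>\<rho>\<close> of the union must preserve every
  component, for then it is glued from its restrictions.

  Suppose \<open>\<rho>\<close> moved \<open>y\<close> out of its component \<open>Q\<^sub>i\<close>. Then \<open>\<rho> y\<close> acts trivially on \<open>Q\<^sub>i\<close>; but it
  acts there as the inverse of \<open>y\<close>, so \<open>y\<close> acts trivially on its own component. This is impossible
  in a nontrivial connected quandle (\<open>connected_nontrivial_acts_nontrivially\<close>): the translation by
  \<open>y \<star> z\<close> is the conjugate of the translation by \<open>y\<close> under the translation by \<open>z\<close>, so the set of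
  elements that act trivially is invariant under the inner group, and by transitivity it is either
  empty or the whole quandle.
\<close>

lemma (in quandle) closed: "x \<in> Q \<Longrightarrow> y \<in> Q \<Longrightarrow> x \<star> y \<in> Q"
  using right_bij bij_betwE by fastforce

lemma (in quandle) right_cancel:
  "x \<in> Q \<Longrightarrow> x' \<in> Q \<Longrightarrow> y \<in> Q \<Longrightarrow> x \<star> y = x' \<star> y \<longleftrightarrow> x = x'"
  using right_bij[of y] by (auto simp: bij_betw_def inj_on_def)

lemma (in quandle) quandle_inv_eq_iff:
  assumes "x \<in> Q" "y \<in> Q" "z \<in> Q"
  shows "z = quandle_inv Q (\<star>) x y \<longleftrightarrow> z \<star> y = x"
proof -
  have bij: "bij_betw (right_translation Q (\<star>) y) Q Q"
    using right_translation_Bij[OF quandle_axioms assms(2)] by (simp add: Bij_def)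
  then have "z = quandle_inv Q (\<star>) x y \<longleftrightarrow> right_translation Q (\<star>) y z = x"
    unfolding quandle_inv_def using assms
    by (metis bij_betw_inv_into_left bij_betw_inv_into_right)
  then show ?thesis
    using assms by (simp add: right_translation_def)
qed

text \<open>Translating both sides of the last axiom by \<open>y\<close> removes the inverse operation from it; in
  this form the axiom can be compared between a union and its components by evaluating products.\<close>

lemma (in quandle) good_involutions_iff:
  "\<rho> \<in> good_involutions Q (\<star>) \<longleftrightarrow>
     \<rho> \<in> Q \<rightarrow>\<^sub>E Q \<and> (\<forall>x\<in>Q. \<rho> (\<rho> x) = x) \<and>
     (\<forall>x\<in>Q. \<forall>y\<in>Q. \<rho> (x \<star> y) = \<rho> x \<star> y) \<and>
     (\<forall>x\<in>Q. \<forall>y\<in>Q. (x \<star> \<rho> y) \<star> y = x)"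
proof -
  have "x \<star> \<rho> y = quandle_inv Q (\<star>) x y \<longleftrightarrow> (x \<star> \<rho> y) \<star> y = x"
    if "\<rho> \<in> Q \<rightarrow>\<^sub>E Q" "x \<in> Q" "y \<in> Q" for x y
    using that by (intro quandle_inv_eq_iff closed) auto
  then show ?thesis
    unfolding good_involutions_def by auto
qed

section \<open>Elements that act trivially\<close>

definition acts_trivially :: "'a set \<Rightarrow> ('a \<Rightarrow> 'a \<Rightarrow> 'a) \<Rightarrow> 'a \<Rightarrow> bool" where
  "acts_trivially Q qop y \<longleftrightarrow> (\<forall>x\<in>Q. qop x y = x)"

text \<open>By self-distributivity, \<open>s\<^bsub>y \<star> z\<^esub> = s\<^sub>z \<circ> s\<^sub>y \<circ> s\<^sub>z\<inverse>\<close> for the translations \<open>s\<^sub>y\<close>.\<close>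

lemma (in quandle) acts_trivially_translate_iff:
  assumes "y \<in> Q" "z \<in> Q"
  shows "acts_trivially Q (\<star>) (y \<star> z) \<longleftrightarrow> acts_trivially Q (\<star>) y"
proof -
  have "acts_trivially Q (\<star>) (y \<star> z) \<longleftrightarrow> (\<forall>x\<in>(\<lambda>x. x \<star> z) ` Q. x \<star> (y \<star> z) = x)"
    unfolding acts_trivially_def using right_bij[OF assms(2)] by (simp only: bij_betw_def)
  also have "\<dots> \<longleftrightarrow> (\<forall>x\<in>Q. (x \<star> y) \<star> z = x \<star> z)"
    using right_distrib assms by auto
  also have "\<dots> \<longleftrightarrow> acts_trivially Q (\<star>) y"
    unfolding acts_trivially_def using assms by (simp add: right_cancel closed)
  finally show ?thesis .
qed

lemma (in quandle) acts_trivially_inner_iff: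
  assumes "g \<in> generate (BijGroup Q) (right_translation Q (\<star>) ` Q)"
  shows "y \<in> Q \<Longrightarrow> acts_trivially Q (\<star>) (g y) \<longleftrightarrow> acts_trivially Q (\<star>) y"
  using assms
proof (induction g arbitrary: y)
  case one
  then show ?case by (simp add: BijGroup_def)
next
  case (incl h)
  then show ?case
    by (auto simp: right_translation_def acts_trivially_translate_iff)
next
  case (inv h)
  then obtain z where z: "z \<in> Q" and h: "h = right_translation Q (\<star>) z" by auto
  have hB: "h \<in> Bij Q"
    unfolding h by (rule right_translation_Bij[OF quandle_axioms z])
  define w where "w = inv_into Q h y"
  have inv_h: "(inv\<^bsub>BijGroup Q\<^esub> h) y = w"
    using hB inv.prems by (simp add: inv_BijGroup w_def)
  have "w \<in> Q" "h w = y"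
    using hB inv.prems unfolding w_def Bij_def bij_betw_def
    by (auto intro: inv_into_into f_inv_into_f)
  then have "w \<star> z = y"
    by (simp add: h right_translation_def)
  then show ?case
    using acts_trivially_translate_iff[OF \<open>w \<in> Q\<close> z] inv_h by simp
next
  case (eng h1 h2)
  have "right_translation Q (\<star>) ` Q \<subseteq> carrier (BijGroup Q)"
    using right_translation_Bij[OF quandle_axioms] by (auto simp: BijGroup_def)
  then have "generate (BijGroup Q) (right_translation Q (\<star>) ` Q) \<subseteq> Bij Q"
    using group.generate_incl[OF group_BijGroup[of Q]] by (simp add: BijGroup_def)
  then have B: "h1 \<in> Bij Q" "h2 \<in> Bij Q"
    using eng.hyps by auto
  then have "h2 y \<in> Q"
    using Bij_imp_funcset eng.prems by (blast dest: funcset_mem)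
  then show ?case
    using eng B by (simp add: BijGroup_def compose_def)
qed

lemma connected_nontrivial_acts_nontrivially:
  assumes "nontrivial_quandle Q qop" "connected_quandle Q qop" "y \<in> Q"
  shows "\<not> acts_trivially Q qop y"
proof
  assume triv: "acts_trivially Q qop y"
  interpret quandle Q qop
    using assms(2) by (simp add: connected_quandle_def)
  have transitive: "\<forall>x\<in>Q. \<forall>z\<in>Q.
      \<exists>g \<in> generate (BijGroup Q) (right_translation Q qop ` Q). g x = z"
    using conjunct2[OF assms(2)[unfolded connected_quandle_def]]
    by (simp only: transitive_inner_group_iff[OF quandle_axioms])
  have "acts_trivially Q qop z" if "z \<in> Q" for z
  proof -
    obtain g where g: "g \<in> generate (BijGroup Q) (right_translation Q qop ` Q)" and "g y = z"
      using bspec[OF bspec[OF transitive assms(3)] \<open>z \<in> Q\<close>] by (rule bexE)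
    then show ?thesis
      using acts_trivially_inner_iff[OF g assms(3)] triv by simp
  qed
  then show False
    using assms(1) quandle_axioms
    by (simp add: nontrivial_quandle_def trivial_quandle_def acts_trivially_def)
qed

section \<open>Good involutions of an interaction-free union\<close>

text \<open>Here \<open>(x \<star> \<rho> y) \<star> y = x\<close> for all \<open>x\<close> in the component of \<open>y\<close>; if \<open>\<rho> y\<close> lay in another
  component, this would read \<open>x \<star> y = x\<close>.\<close>

lemma good_involution_preserves_components:
  assumes quandles: "\<And>i. i \<in> L \<Longrightarrow> quandle (Q i) (qop i)"
    and nontriv: "\<And>i y. i \<in> L \<Longrightarrow> y \<in> Q i \<Longrightarrow> \<not> acts_trivially (Q i) (qop i) y"
    and \<rho>: "\<rho> \<in> good_involutions (Sigma L Q) (free_union_op qop)"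
    and y: "i \<in> L" "y \<in> Q i"
  shows "fst (\<rho> (i, y)) = i"
proof (rule ccontr)
  assume neq: "fst (\<rho> (i, y)) \<noteq> i"
  have union: "quandle (Sigma L Q) (free_union_op qop)"
    by (rule quandle_free_union) (rule quandles)
  have "free_union_op qop (free_union_op qop (i, x) (\<rho> (i, y))) (i, y) = (i, x)"
    if "x \<in> Q i" for x
  proof -
    have "(i, x) \<in> Sigma L Q" "(i, y) \<in> Sigma L Q"
      using y that by auto
    then show ?thesis
      using \<rho> unfolding quandle.good_involutions_iff[OF union] by blast
  qed
  then have "qop i x y = x" if "x \<in> Q i" for x
    using that neq by (auto simp: free_union_op_def)
  then show False
    using nontriv[OF y] by (simp add: acts_trivially_def)
qed

definition glue_maps ::
    "'i set \<Rightarrow> ('i \<Rightarrow> 'a set) \<Rightarrow> ('i \<Rightarrow> 'a \<Rightarrow> 'a) \<Rightarrow> 'i \<times> 'a \<Rightarrow> 'i \<times> 'a" where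
  "glue_maps L Q f = (\<lambda>p\<in>Sigma L Q. (fst p, f (fst p) (snd p)))"

lemma component_maps_glue_maps:
  assumes "f \<in> (\<Pi>\<^sub>E i\<in>L. Q i \<rightarrow>\<^sub>E Q i)"
  shows "component_maps L Q (glue_maps L Q f) = f"
proof (intro ext)
  fix i x
  show "component_maps L Q (glue_maps L Q f) i x = f i x"
  proof (cases "i \<in> L")
    case True
    then have "f i \<in> Q i \<rightarrow>\<^sub>E Q i" by (rule PiE_mem[OF assms])
    then have "f i x = undefined" if "x \<notin> Q i"
      using that by (rule PiE_arb)
    then show ?thesis
      using True by (simp add: component_maps_def glue_maps_def)
  next
    case False
    then show ?thesis
      using PiE_arb[OF assms False] by (simp add: component_maps_def)
  qed
qed

lemma glue_maps_component_maps:
  assumes "\<rho> \<in> Sigma L Q \<rightarrow>\<^sub>E Sigma L Q"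
    and "\<And>i x. i \<in> L \<Longrightarrow> x \<in> Q i \<Longrightarrow> fst (\<rho> (i, x)) = i"
  shows "glue_maps L Q (component_maps L Q \<rho>) = \<rho>"
proof
  fix p
  show "glue_maps L Q (component_maps L Q \<rho>) p = \<rho> p"
  proof (cases "p \<in> Sigma L Q")
    case True
    then show ?thesis
      using assms(2)[of "fst p" "snd p"]
      by (auto simp: glue_maps_def component_maps_def prod_eq_iff)
  next
    case False
    then show ?thesis
      using PiE_arb[OF assms(1) False] unfolding glue_maps_def
      by (simp only: restrict_apply if_False)
  qed
qed

text \<open>The axioms for \<open>x\<close> and \<open>y\<close> in one component are exactly those of that component, and for
  \<open>x\<close> and \<open>y\<close> in distinct components they hold because the glued map preserves components.\<close>

lemma glue_maps_good_iff:
  assumes quandles: "\<And>i. i \<in> L \<Longrightarrow> quandle (Q i) (qop i)"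
    and f: "f \<in> (\<Pi>\<^sub>E i\<in>L. Q i \<rightarrow>\<^sub>E Q i)"
  shows "glue_maps L Q f \<in> good_involutions (Sigma L Q) (free_union_op qop) \<longleftrightarrow>
    (\<forall>i\<in>L. f i \<in> good_involutions (Q i) (qop i))"
proof -
  let ?S = "Sigma L Q" and ?op = "free_union_op qop" and ?g = "glue_maps L Q f"
  have union: "quandle ?S ?op"
    by (rule quandle_free_union) (rule quandles)
  have fQ: "f i x \<in> Q i" if "i \<in> L" "x \<in> Q i" for i x
    using PiE_mem[OF PiE_mem[OF f]] that .
  have g: "?g (i, x) = (i, f i x)" if "i \<in> L" "x \<in> Q i" for i x
    using that by (simp add: glue_maps_def)
  have closed: "qop i x y \<in> Q i" if "i \<in> L" "x \<in> Q i" "y \<in> Q i" for i x y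
    using quandle.closed[OF quandles] that by blast
  have "?g \<in> ?S \<rightarrow>\<^sub>E ?S"
    using fQ by (auto simp: glue_maps_def)
  moreover have "(\<forall>p\<in>?S. ?g (?g p) = p) \<longleftrightarrow> (\<forall>i\<in>L. \<forall>x\<in>Q i. f i (f i x) = x)"
    by (auto simp: g fQ)
  moreover have "(\<forall>p\<in>?S. \<forall>q\<in>?S. ?g (?op p q) = ?op (?g p) q) \<longleftrightarrow>
      (\<forall>i\<in>L. \<forall>x\<in>Q i. \<forall>y\<in>Q i. f i (qop i x y) = qop i (f i x) y)"
    by (auto simp: g fQ closed free_union_op_def)
  moreover have "(\<forall>p\<in>?S. \<forall>q\<in>?S. ?op (?op p (?g q)) q = p) \<longleftrightarrow>
      (\<forall>i\<in>L. \<forall>x\<in>Q i. \<forall>y\<in>Q i. qop i (qop i x (f i y)) y = x)"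
    by (auto simp: g fQ closed free_union_op_def)
  moreover have "\<forall>i\<in>L. f i \<in> Q i \<rightarrow>\<^sub>E Q i"
    using PiE_mem[OF f] by blast
  ultimately show ?thesis
    by (simp add: quandle.good_involutions_iff[OF union]
        quandle.good_involutions_iff[OF quandles] ball_conj_distrib)
qed

theorem theorem1p2:
  fixes L :: "'i set" and Q :: "'i \<Rightarrow> 'a set" and qop :: "'i \<Rightarrow> 'a \<Rightarrow> 'a \<Rightarrow> 'a"
  assumes "\<And>i. i \<in> L \<Longrightarrow> nontrivial_quandle (Q i) (qop i)"
    and "\<And>i. i \<in> L \<Longrightarrow> connected_quandle (Q i) (qop i)"
  shows "bij_betw (component_maps L Q)
           (good_involutions (Sigma L Q) (free_union_op qop))
           (\<Pi>\<^sub>E i\<in>L. good_involutions (Q i) (qop i))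
       \<and> (\<forall>\<rho>\<in>good_involutions (Sigma L Q) (free_union_op qop).
            \<forall>i\<in>L. \<forall>x\<in>Q i. \<rho> (i, x) = (i, component_maps L Q \<rho> i x))"
proof -
  let ?G = "good_involutions (Sigma L Q) (free_union_op qop)"
  let ?P = "\<Pi>\<^sub>E i\<in>L. good_involutions (Q i) (qop i)"
  have quandles: "quandle (Q i) (qop i)" if "i \<in> L" for i
    using assms(2)[OF that] by (simp add: connected_quandle_def)
  have nontriv: "\<not> acts_trivially (Q i) (qop i) y" if "i \<in> L" "y \<in> Q i" for i y
    using connected_nontrivial_acts_nontrivially assms that by metis
  have preserves: "fst (\<rho> (i, x)) = i" if "\<rho> \<in> ?G" "i \<in> L" "x \<in> Q i" for \<rho> i x
    using good_involution_preserves_components quandles nontriv that by metis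
  have maps: "\<rho> \<in> Sigma L Q \<rightarrow>\<^sub>E Sigma L Q" if "\<rho> \<in> ?G" for \<rho>
    using that by (simp add: good_involutions_def)
  have families: "f \<in> (\<Pi>\<^sub>E i\<in>L. Q i \<rightarrow>\<^sub>E Q i)" if "f \<in> ?P" for f
    using that by (auto simp: good_involutions_def PiE_iff)
  have glue: "glue_maps L Q (component_maps L Q \<rho>) = \<rho>" if "\<rho> \<in> ?G" for \<rho>
    by (rule glue_maps_component_maps) (use maps preserves that in blast)+
  have restrict: "component_maps L Q \<rho> \<in> ?P" if "\<rho> \<in> ?G" for \<rho>
  proof -
    have "snd (\<rho> (i, x)) \<in> Q i" if "i \<in> L" "x \<in> Q i" for i x
    proof -
      have "\<rho> (i, x) \<in> Sigma L Q"
        using PiE_mem[OF maps[OF \<open>\<rho> \<in> ?G\<close>]] that by blast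
      then show ?thesis
        using preserves[OF \<open>\<rho> \<in> ?G\<close> that] by (metis SigmaD2 prod.collapse)
    qed
    then have family: "component_maps L Q \<rho> \<in> (\<Pi>\<^sub>E i\<in>L. Q i \<rightarrow>\<^sub>E Q i)"
      by (simp add: component_maps_def restrict_PiE_iff)
    have "glue_maps L Q (component_maps L Q \<rho>) \<in> ?G"
      using glue that by simp
    then have "\<forall>i\<in>L. component_maps L Q \<rho> i \<in> good_involutions (Q i) (qop i)"
      using glue_maps_good_iff[OF quandles family] by blast
    then show ?thesis
      using family by (simp add: PiE_iff)
  qed
  have "bij_betw (component_maps L Q) ?G ?P"
  proof (rule bij_betw_byWitness[where f' = "glue_maps L Q"])
    show "\<forall>\<rho>\<in>?G. glue_maps L Q (component_maps L Q \<rho>) = \<rho>"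
      using glue by blast
    show "\<forall>f\<in>?P. component_maps L Q (glue_maps L Q f) = f"
      by (intro ballI component_maps_glue_maps families)
    show "component_maps L Q ` ?G \<subseteq> ?P"
      by (intro image_subsetI restrict)
    show "glue_maps L Q ` ?P \<subseteq> ?G"
    proof (rule image_subsetI)
      fix f assume "f \<in> ?P"
      then show "glue_maps L Q f \<in> ?G"
        using glue_maps_good_iff[OF quandles families] by (simp add: PiE_iff)
    qed
  qed
  moreover have "\<forall>\<rho>\<in>?G. \<forall>i\<in>L. \<forall>x\<in>Q i. \<rho> (i, x) = (i, component_maps L Q \<rho> i x)"
    by (intro ballI prod_eqI) (simp_all add: component_maps_def preserves)
  ultimately show ?thesis ..
qed

end
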